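(* Let $n_1$ and $n_2$ be two positive integers such that $$ \left\{ \begin{array}{ll} \mathrm{rad}(n_1)\mid n_2\ \text{and}\ n_2\mid n_1, & \text{if}\ v_2(n_1)\leq 1;\\ 2\,\mathrm{rad}(n_1)\mid n_2\ \text{and}\ n_2\mid n_1, & \text{if}\ v_2(n_1)\geq 2. \end{array} \right. $$ Let $a$ be an integer coprime to $n_1$ and $n_2$. Then we have $$ \beta_{n_1}(a) = \frac{\beta_{n_2}(a)}{\gcd\left(\beta_{n_2}(a),\frac{\gcd(n_1,\mathcal{R}_{n_2}(a))}{n_2}\right)}. $$
   Context: For a prime $p$ and a positive integer $n$, $v_p(n)$ is the $p$-adic valuation of $n$, and $\mathrm{rad}(n)=\prod_{p\mid n,\ p\text{ prime}}p$ is the largest square-free divisor of $n$. For an integer $a$ coprime to a positive integer $n$, $\mathcal{O}_n(a)$ is the multiplicative order of $a$ modulo $n$, i.e. the smallest positive integer $e$ with $a^e\equiv 1\pmod n$; $\mathcal{R}_n(a)=a^{\mathcal{O}_n(a)}-1$ (an integer, multiple of $n$); and $\mathcal{PO}_n(a)$ is the projective multiplicative order of $a$ modulo $n$, i.e. the smallest positive integer $e$ with $a^e\equiv 1$ or $a^e\equiv -1\pmod n$. The function $\beta_n:\mathbb{Z}\to\mathbb{N}$ is defined by $\beta_n(a)=\mathcal{PO}_n(a^n)$ if $\gcd(a,n)=1$, and $\beta_n(a)=0$ otherwise. Convention: $\gcd(0,n)=n$. *)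

theory Defs
  imports "HOL-Number_Theory.Number_Theory"
begin

definition rad :: "nat \<Rightarrow> nat" where
  "rad n = \<Prod> (prime_factors n)"

text \<open>The multiplicative order is the library's \<^const>\<open>ord\<close>, used at type \<^typ>\<open>int\<close>
  because the base may be negative.\<close>

definition mult_rem :: "nat \<Rightarrow> int \<Rightarrow> int" where
  "mult_rem n a = a ^ ord (int n) a - 1"

definition proj_ord :: "nat \<Rightarrow> int \<Rightarrow> nat" where
  "proj_ord n a = (LEAST e. 0 < e \<and> ([a ^ e = 1] (mod int n) \<or> [a ^ e = - 1] (mod int n)))"

definition beta :: "nat \<Rightarrow> int \<Rightarrow> nat" where
  "beta n a = (if coprime a (int n) then proj_ord n (a ^ n) else 0)"

text \<open>For a positive modulus and a base coprime to it, the minima above are attained.\<close>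

lemma ex_power_cong_1:
  fixes a :: int
  assumes "0 < n" "coprime a (int n)"
  shows "\<exists>e>0. [a ^ e = 1] (mod int n)"
proof -
  define b where "b = nat (a mod int n)"
  have b: "int b = a mod int n"
    using assms(1) by (simp add: b_def)
  have "coprime (int b) (int n)"
    using assms by (simp add: b)
  then have "coprime b n"
    by simp
  then have "[b ^ totient n = 1] (mod n)"
    by (rule euler_theorem)
  then have "[int b ^ totient n = 1] (mod int n)"
    by (metis cong_int_iff of_nat_1 of_nat_power)
  then have "[a ^ totient n = 1] (mod int n)"
    by (simp add: b cong_def power_mod)
  then show ?thesis
    using assms(1) by (intro exI[of _ "totient n"]) simp
qed

lemma dvd_mult_rem:
  assumes "0 < n" "coprime a (int n)"
  shows "int n dvd mult_rem n a"
proof -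
  have "[a ^ ord (int n) a = 1] (mod int n)"
    using LeastI_ex[OF ex_power_cong_1[OF assms]] assms(2)
    by (simp add: ord_def coprime_commute)
  then show ?thesis
    by (simp add: mult_rem_def cong_iff_dvd_diff)
qed

lemma proj_ord_works:
  assumes "0 < n" "coprime a (int n)"
  shows "0 < proj_ord n a"
    and "[a ^ proj_ord n a = 1] (mod int n) \<or> [a ^ proj_ord n a = - 1] (mod int n)"
proof -
  have "\<exists>e>0. [a ^ e = 1] (mod int n) \<or> [a ^ e = - 1] (mod int n)"
    using ex_power_cong_1[OF assms] by blast
  from LeastI_ex[OF this]
  show "0 < proj_ord n a"
    and "[a ^ proj_ord n a = 1] (mod int n) \<or> [a ^ proj_ord n a = - 1] (mod int n)"
    by (auto simp: proj_ord_def)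
qed

text \<open>Hence the division \<open>gcd n\<^sub>1 (mult_rem n\<^sub>2 a) div n\<^sub>2\<close> is exact whenever
  \<open>n\<^sub>2\<close> divides \<open>n\<^sub>1\<close>.\<close>

lemma dvd_gcd_mult_rem:
  assumes "0 < n\<^sub>2" "coprime a (int n\<^sub>2)" "n\<^sub>2 dvd n\<^sub>1"
  shows "n\<^sub>2 dvd nat (gcd (int n\<^sub>1) (mult_rem n\<^sub>2 a))"
  using dvd_mult_rem[OF assms(1,2)] assms(3) by (simp add: nat_dvd_iff flip: int_dvd_int_iff)

end

(* By lifting the exponent, x = 1 (mod n2) implies that n1 divides x^m - 1 iff it divides
   (x - 1) m. Applied to x = a^ord(n2, a), this gives
   ord(n1, a) = ord(n2, a) (n1 / n2) / G with G = gcd(n1, R_n2(a)) / n2,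
   which is the theorem with the order of a^n in place of its projective order.
   The two orders differ by the factor 2 exactly when -1 is a power of a^n modulo n > 2.
   If 4 | n this is impossible. Otherwise n1 / n2 is odd, so -1 occurs for n1 iff it occurs
   for n2, and the factor 2 cancels because G is odd. *)

theory Submission
  imports Defs
begin

section \<open>Multiplicative orders of integer bases\<close>

lemma ord_int_eq_nat:
  fixes a :: int
  assumes "0 < n"
  shows "ord (int n) a = ord n (nat (a mod int n))"
proof -
  define b where "b = nat (a mod int n)"
  have b: "int b = a mod int n"
    using assms by (simp add: b_def)
  have "coprime (int n) a \<longleftrightarrow> coprime n b"
    using assms by (simp flip: coprime_int_iff add: b coprime_commute)
  moreover have "[a ^ d = 1] (mod int n) \<longleftrightarrow> [b ^ d = 1] (mod n)" for d
    by (simp flip: cong_int_iff add: b) (simp add: cong_def power_mod)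
  ultimately show ?thesis
    by (simp add: ord_def flip: b_def)
qed

text \<open>For a base not coprime to \<open>n\<close>, \<open>ord\<close> has the default value 0
  and both sides say \<open>d = 0\<close>.\<close>

lemma ord_int_divides:
  fixes a :: int
  assumes "0 < n"
  shows "[a ^ d = 1] (mod int n) \<longleftrightarrow> ord (int n) a dvd d"
proof -
  have "[a ^ d = 1] (mod int n) \<longleftrightarrow> [nat (a mod int n) ^ d = 1] (mod n)"
    using assms by (simp flip: cong_int_iff) (simp add: cong_def power_mod)
  then show ?thesis
    using assms by (simp only: ord_int_eq_nat ord_divides)
qed

lemma ord_int_pos:
  fixes a :: int
  assumes "0 < n" "coprime a (int n)"
  shows "0 < ord (int n) a"
  using ex_power_cong_1[OF assms] assms(1) by (auto simp: ord_int_divides intro: Nat.gr0I)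

text \<open>With \<open>l\<close> the order of \<open>a\<close>, the multiples of the new order are
  the \<open>t\<close> with \<open>l dvd k * t\<close>. Cancelling \<open>gcd l k\<close> leaves two
  coprime quotients, and natural numbers with the same multiples are equal.\<close>

lemma ord_int_power:
  fixes a :: int
  assumes "0 < n" "coprime a (int n)"
  shows "ord (int n) (a ^ k) = ord (int n) a div gcd (ord (int n) a) k"
proof -
  define l where "l = ord (int n) a"
  have l: "l > 0" using ord_int_pos[OF assms] by (simp add: l_def)
  have "ord (int n) (a ^ k) dvd t \<longleftrightarrow> l div gcd l k dvd t" for t
  proof -
    have "ord (int n) (a ^ k) dvd t \<longleftrightarrow> l dvd k * t"
      using assms(1) by (simp add: l_def flip: ord_int_divides power_mult)
    also have "\<dots> \<longleftrightarrow> l div gcd l k * gcd l k dvd (k div gcd l k * t) * gcd l k"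
      by (simp add: mult.commute mult.left_commute)
    also have "\<dots> \<longleftrightarrow> l div gcd l k dvd k div gcd l k * t"
      using l by (subst dvd_times_right_cancel_iff) auto
    also have "\<dots> \<longleftrightarrow> l div gcd l k dvd t"
      using l by (intro coprime_dvd_mult_right_iff div_gcd_coprime) auto
    finally show ?thesis .
  qed
  then show ?thesis
    unfolding l_def by (meson dvd_antisym dvd_refl)
qed

section \<open>Lifting the exponent\<close>

text \<open>The cofactor of \<open>y - 1\<close> in \<open>y ^ p - 1\<close> contains exactly one
  factor \<open>p\<close>. For \<open>y = 1 + p t\<close>, the sum is congruent to
  \<open>p + p t * (p (p - 1) / 2)\<close> modulo \<open>p ^ 2\<close>. The second term vanishes for
  odd \<open>p\<close>; for \<open>p = 2\<close> it is \<open>2 t = y - 1\<close>, which is why 4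
  must divide \<open>y - 1\<close>.\<close>

lemma geometric_sum_prime:
  fixes y :: int and p :: nat
  assumes "prime p" "int p dvd y - 1" "p = 2 \<Longrightarrow> 4 dvd y - 1"
  obtains u where "(\<Sum>i<p. y ^ i) = int p * u" "[u = 1] (mod int p)"
proof -
  obtain t where t: "y = 1 + int p * t"
    using assms(2) by (metis add.commute diff_add_cancel dvdE)
  have pow: "[y ^ i = 1 + int i * (int p * t)] (mod int p ^ 2)" for i
  proof (induction i)
    case (Suc i)
    have "[y ^ Suc i = (1 + int p * t) * (1 + int i * (int p * t))] (mod int p ^ 2)"
      using cong_scalar_left[OF Suc.IH, of y] by (simp add: t)
    also have "(1 + int p * t) * (1 + int i * (int p * t)) =
        1 + int (Suc i) * (int p * t) + int p ^ 2 * (int i * t ^ 2)"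
      by (simp add: algebra_simps power2_eq_square)
    also have "[\<dots> = 1 + int (Suc i) * (int p * t)] (mod int p ^ 2)"
      by (simp add: cong_iff_dvd_diff)
    finally show ?case .
  qed auto
  have "int p ^ 2 dvd (\<Sum>i<p. int i * (int p * t))"
  proof (cases "p = 2")
    case True
    with assms(3) show ?thesis
      by (simp add: t numeral_2_eq_2)
  next
    case False
    with assms(1) have "odd p"
      using prime_odd_nat prime_ge_2_nat by (metis le_neq_implies_less)
    then obtain r where r: "p = 2 * r + 1" by (rule oddE)
    have "(\<Sum>i<p. int i) = int p * int r"
      unfolding r by (induction r) (auto simp: algebra_simps)
    then have "(\<Sum>i<p. int i * (int p * t)) = int p ^ 2 * (int r * t)"
      by (simp add: power2_eq_square flip: sum_distrib_right)
    then show ?thesis by simp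
  qed
  moreover have "[(\<Sum>i<p. y ^ i) = (\<Sum>i<p. 1 + int i * (int p * t))] (mod int p ^ 2)"
    by (intro cong_sum pow)
  ultimately have "int p ^ 2 dvd (\<Sum>i<p. y ^ i) - (\<Sum>i<p. 1 + int i * (int p * t)) +
      (\<Sum>i<p. int i * (int p * t))"
    unfolding cong_iff_dvd_diff by (intro dvd_add)
  then have "int p ^ 2 dvd (\<Sum>i<p. y ^ i) - int p"
    unfolding sum.distrib by simp
  then obtain v where "(\<Sum>i<p. y ^ i) - int p = int p ^ 2 * v" by (elim dvdE)
  then have v: "(\<Sum>i<p. y ^ i) = int p + int p ^ 2 * v" by linarith
  show thesis
  proof
    show "(\<Sum>i<p. y ^ i) = int p * (1 + int p * v)"
      using v by (simp add: algebra_simps power2_eq_square)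
  qed (simp add: cong_iff_dvd_diff)
qed

lemma prime_power_dvd_mult_cancel:
  fixes u z :: int and p :: nat
  assumes "prime p" "\<not> int p dvd u"
  shows "int p ^ s dvd z * u \<longleftrightarrow> int p ^ s dvd z"
proof -
  have "coprime (int p) u"
    using assms by (intro prime_imp_coprime) auto
  then show ?thesis
    by (intro coprime_dvd_mult_left_iff) simp
qed

text \<open>A form of lifting the exponent which stays meaningful for \<open>x = 1\<close>, where valuations
  would be undefined; the factor \<open>c\<close> carries the induction over the prime factors of \<open>m\<close>.\<close>

lemma prime_power_dvd_power_minus_1_iff:
  fixes c x :: int and p :: nat
  assumes "prime p" "int p dvd x - 1" "p = 2 \<Longrightarrow> 4 dvd x - 1"
  shows "int p ^ s dvd c * (x ^ m - 1) \<longleftrightarrow> int p ^ s dvd c * (x - 1) * int m"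
proof (induction m arbitrary: c rule: prime_divisors_induct)
  case (factor q m)
  define y where "y = x ^ m"
  have xy: "x - 1 dvd y - 1"
    unfolding y_def by (simp add: power_diff_1_eq)
  have y: "int p dvd y - 1" "p = 2 \<Longrightarrow> 4 dvd y - 1"
    using assms xy by (auto intro: dvd_trans)
  \<comment> \<open>One prime \<open>q\<close> is peeled off by
    \<open>y ^ q - 1 = (y - 1) * (\<Sum>i<q. y ^ i)\<close>. For \<open>q = p\<close> the sum is
    \<open>p\<close> times a unit modulo \<open>p\<close>. Otherwise the sum is congruent to
    \<open>q\<close>, and both are units modulo \<open>p\<close>.\<close>
  have "int p ^ s dvd c * (y ^ q - 1) \<longleftrightarrow> int p ^ s dvd c * (y - 1) * int q"
  proof (cases "q = p")
    case True
    from geometric_sum_prime[OF assms(1) y] obtain u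
      where u: "(\<Sum>i<p. y ^ i) = int p * u" "[u = 1] (mod int p)" .
    have "\<not> int p dvd u"
      using u(2) assms(1) by (metis cong_dvd_iff int_dvd_int_iff nat_dvd_1_iff_1 not_prime_1 of_nat_1)
    from prime_power_dvd_mult_cancel[OF assms(1) this] show ?thesis
      by (simp add: power_diff_1_eq True u(1) flip: mult.assoc)
  next
    case False
    have "[(\<Sum>i<q. y ^ i) = (\<Sum>i<q. 1 ^ i)] (mod int p)"
      using y(1) by (intro cong_sum cong_pow) (simp add: cong_iff_dvd_diff)
    moreover have "\<not> int p dvd int q"
      using False assms(1) factor.hyps by (auto dest: primes_dvd_imp_eq)
    ultimately have "\<not> int p dvd (\<Sum>i<q. y ^ i)" "\<not> int p dvd int q"
      by (auto dest: cong_dvd_iff)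
    with prime_power_dvd_mult_cancel[OF assms(1)] show ?thesis
      by (simp add: power_diff_1_eq flip: mult.assoc)
  qed
  moreover have "int p ^ s dvd (c * int q) * (y - 1) \<longleftrightarrow> int p ^ s dvd (c * int q) * (x - 1) * int m"
    unfolding y_def by (rule factor.IH)
  ultimately show ?case
    by (simp add: y_def mult_ac flip: power_mult)
qed auto

lemma int_dvd_iff_prime_powers:
  fixes z :: int
  assumes "0 < n"
  shows "int n dvd z \<longleftrightarrow> (\<forall>p. prime p \<longrightarrow> int p ^ multiplicity p n dvd z)"
\<comment> \<open>\<open>multiplicity\<close> at 0 is 0 by default, so comparing multiplicities is
  valid only for nonzero \<open>z\<close>.\<close>
proof (cases "z = 0")
  case False
  have "n dvd nat \<bar>z\<bar> \<longleftrightarrow> (\<forall>p. prime p \<longrightarrow> p ^ multiplicity p n dvd nat \<bar>z\<bar>)"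
  proof (intro iffI allI impI)
    assume *: "\<forall>p. prime p \<longrightarrow> p ^ multiplicity p n dvd nat \<bar>z\<bar>"
    show "n dvd nat \<bar>z\<bar>"
    proof (rule multiplicity_le_imp_dvd)
      fix p :: nat
      assume "prime p"
      with * have "p ^ multiplicity p n dvd nat \<bar>z\<bar>" by blast
      then show "multiplicity p n \<le> multiplicity p (nat \<bar>z\<bar>)"
        using False \<open>prime p\<close> by (intro multiplicity_geI) (auto dest: prime_gt_1_nat)
    qed (use assms in simp)
  qed (meson multiplicity_dvd dvd_trans)
  moreover have "int m dvd z \<longleftrightarrow> m dvd nat \<bar>z\<bar>" for m
    by simp
  ultimately show ?thesis
    by (simp only: of_nat_power [symmetric])
qed simp

lemma dvd_power_minus_1_iff:
  fixes x :: int
  assumes "0 < n" "\<And>p. prime p \<Longrightarrow> p dvd n \<Longrightarrow> int p dvd x - 1" "4 dvd n \<Longrightarrow> 4 dvd x - 1"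
  shows "int n dvd x ^ m - 1 \<longleftrightarrow> int n dvd (x - 1) * int m"
proof -
  have "int p ^ multiplicity p n dvd x ^ m - 1 \<longleftrightarrow> int p ^ multiplicity p n dvd (x - 1) * int m"
    if p: "prime p" for p
  proof (cases "p dvd n \<and> (p = 2 \<longrightarrow> 4 dvd n)")
    case True
    with prime_power_dvd_power_minus_1_iff[of p x _ 1 m] p assms show ?thesis
      by auto
  next
    case False
    \<comment> \<open>Either the exponent is 0, or \<open>p = 2\<close> divides \<open>n\<close>
      exactly once and 4 need not divide \<open>x - 1\<close>. In both cases the prime power already
      divides \<open>x - 1\<close>, hence both sides.\<close>
    have "int p ^ multiplicity p n dvd x - 1"
    proof (cases "p dvd n")
      case True
      with False have "p = 2" "\<not> 2 ^ 2 dvd n" by auto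
      then have "multiplicity p n \<le> 1"
        using multiplicity_dvd'[of 2 p n] by fastforce
      then have "int p ^ multiplicity p n dvd int p ^ 1"
        by (rule le_imp_power_dvd)
      with assms(2)[OF p True] show ?thesis
        by (auto intro: dvd_trans)
    qed (simp add: not_dvd_imp_multiplicity_0)
    then show ?thesis
      by (simp add: power_diff_1_eq)
  qed
  with assms(1) show ?thesis
    by (simp add: int_dvd_iff_prime_powers)
qed

section \<open>Projective order against order\<close>

lemma proj_ord_eq_ord:
  fixes x :: int
  assumes "\<And>j. \<not> [x ^ j = - 1] (mod int n)" "0 < n" "coprime x (int n)"
  shows "proj_ord n x = ord (int n) x"
  using assms by (simp add: proj_ord_def ord_def coprime_commute)

text \<open>The least exponent \<open>P\<close> reaches -1 rather than 1, so the order exceeds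
  \<open>P\<close> and divides \<open>2 * P\<close>; hence it equals \<open>2 * P\<close>. The bound
  \<open>2 < n\<close> keeps 1 and -1 distinct.\<close>

lemma ord_eq_double_proj_ord:
  fixes x :: int
  assumes "[x ^ j = - 1] (mod int n)" "2 < n" "coprime x (int n)"
  shows "ord (int n) x = 2 * proj_ord n x"
proof -
  have n: "0 < n" using assms(2) by simp
  have neq: "\<not> [1 = - 1] (mod int n)"
    using assms(2) zdvd_imp_le[of "int n" 2] by (auto simp: cong_iff_dvd_diff)
  define P where "P = proj_ord n x"
  have P: "0 < P" "[x ^ P = 1] (mod int n) \<or> [x ^ P = - 1] (mod int n)"
    using proj_ord_works[OF n assms(3)] by (auto simp: P_def)
  have min: "P \<le> e" if "0 < e" "[x ^ e = 1] (mod int n) \<or> [x ^ e = - 1] (mod int n)" for e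
    unfolding P_def proj_ord_def using that by (intro Least_le) auto
  have not1: "\<not> [x ^ P = 1] (mod int n)"
  proof
    assume 1: "[x ^ P = 1] (mod int n)"
    have "x ^ j = (x ^ P) ^ (j div P) * x ^ (j mod P)"
      by (simp flip: power_mult power_add)
    also have "[\<dots> = 1 ^ (j div P) * x ^ (j mod P)] (mod int n)"
      by (intro cong_mult cong_pow 1 cong_refl)
    finally have 2: "[x ^ (j mod P) = - 1] (mod int n)"
      using assms(1) by (simp add: cong_def)
    \<comment> \<open>A nonzero remainder would be an exponent below \<open>P\<close> that reaches
      -1, against minimality.\<close>
    then have "j mod P = 0"
      using min[of "j mod P"] P(1) by (meson leD mod_less_divisor neq0_conv)
    with 2 neq show False by simp
  qed
  with P(2) have m1: "[x ^ P = - 1] (mod int n)" by blast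
  then have "[(x ^ P) ^ 2 = (- 1) ^ 2] (mod int n)"
    by (rule cong_pow)
  then have "ord (int n) x dvd P * 2"
    using n by (simp flip: ord_int_divides add: power_mult)
  then obtain m where m: "P * 2 = ord (int n) x * m" by (elim dvdE)
  have "[x ^ ord (int n) x = 1] (mod int n)"
    using n by (simp add: ord_int_divides)
  with min[of "ord (int n) x"] not1 ord_int_pos[OF n assms(3)]
  have "P < ord (int n) x" by (metis le_neq_implies_less)
  moreover have "m \<noteq> 0" using m P(1) by (intro notI) auto
  moreover have "m < 2"
  proof (rule ccontr)
    assume "\<not> m < 2"
    then have "ord (int n) x * 2 \<le> P * 2" unfolding m by simp
    with \<open>P < ord (int n) x\<close> show False by simp
  qed
  ultimately have "m = 1" by simp
  with m show ?thesis by (simp add: P_def)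
qed

section \<open>Passing from the modulus \<open>n\<^sub>2\<close> to \<open>n\<^sub>1\<close>\<close>

text \<open>Both cases of the hypothesis in one form: \<open>primes\<close> encodes that
  \<open>rad n\<^sub>1\<close> divides \<open>n\<^sub>2\<close>, and \<open>four\<close> is what the
  extra factor 2 provides. Together they allow lifting the exponent for every \<open>x\<close>
  congruent to 1 modulo \<open>n\<^sub>2\<close>.\<close>

locale divisor_with_same_primes =
  fixes n\<^sub>1 n\<^sub>2 :: nat
  assumes pos: "0 < n\<^sub>1"
    and dvd: "n\<^sub>2 dvd n\<^sub>1"
    and primes: "\<And>p. prime p \<Longrightarrow> p dvd n\<^sub>1 \<Longrightarrow> p dvd n\<^sub>2"
    and four: "4 dvd n\<^sub>1 \<Longrightarrow> 4 dvd n\<^sub>2"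
begin

lemma pos2: "0 < n\<^sub>2"
  using pos dvd by (auto intro: Nat.gr0I)

lemma coprime2: "coprime a (int n\<^sub>1) \<Longrightarrow> coprime a (int n\<^sub>2)"
  using dvd by (meson coprime_divisors dvd_refl int_dvd_int_iff)

lemma dvd_power_iff:
  fixes x :: int
  assumes "[x = 1] (mod int n\<^sub>2)"
  shows "[x ^ m = 1] (mod int n\<^sub>1) \<longleftrightarrow> int n\<^sub>1 dvd (x - 1) * int m"
proof -
  have n2: "int n\<^sub>2 dvd x - 1"
    using assms by (simp add: cong_iff_dvd_diff)
  have "int p dvd x - 1" if "prime p" "p dvd n\<^sub>1" for p
    using primes[OF that] n2 by (meson dvd_trans int_dvd_int_iff)
  moreover have "4 dvd x - 1" if "4 dvd n\<^sub>1"
    using four[OF that] n2 by (metis dvd_trans int_dvd_int_iff of_nat_numeral)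
  ultimately show ?thesis
    using pos by (simp add: cong_iff_dvd_diff dvd_power_minus_1_iff)
qed

text \<open>The number G of the introductory comment.\<close>

definition gcd_quot :: "int \<Rightarrow> nat" where
  "gcd_quot a = nat (gcd (int n\<^sub>1) (mult_rem n\<^sub>2 a)) div n\<^sub>2"

lemma gcd_quot_mult:
  assumes "coprime a (int n\<^sub>1)"
  shows "nat (gcd (int n\<^sub>1) (mult_rem n\<^sub>2 a)) = n\<^sub>2 * gcd_quot a"
  using dvd_gcd_mult_rem[OF pos2 coprime2[OF assms] dvd] by (simp add: gcd_quot_def)

lemma gcd_quot_dvd:
  assumes "coprime a (int n\<^sub>1)"
  shows "n\<^sub>2 * gcd_quot a dvd n\<^sub>1"
  using gcd_quot_mult[OF assms] by (metis gcd_dvd1 gcd_ge_0_int int_dvd_int_iff int_nat_eq)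

text \<open>Reduction modulo \<open>n\<^sub>2\<close> shows that the order modulo
  \<open>n\<^sub>1\<close> is \<open>l * m\<close> for some \<open>m\<close>, with \<open>l\<close>
  the order modulo \<open>n\<^sub>2\<close>. Lifting the exponent at \<open>a ^ l\<close> shows that
  \<open>l * m\<close> is a valid exponent iff \<open>n\<^sub>1\<close> divides
  \<open>mult_rem n\<^sub>2 a * m\<close>; removing the gcd turns this into a condition on
  \<open>m\<close> alone.\<close>

lemma ord_lift:
  assumes a: "coprime a (int n\<^sub>1)"
  shows "ord (int n\<^sub>1) a = ord (int n\<^sub>2) a * (n\<^sub>1 div (n\<^sub>2 * gcd_quot a))"
proof -
  define l where "l = ord (int n\<^sub>2) a"
  define g where "g = n\<^sub>2 * gcd_quot a"
  have g: "int g = gcd (int n\<^sub>1) (mult_rem n\<^sub>2 a)" "g dvd n\<^sub>1" "0 < g"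
    using gcd_quot_mult[OF a, symmetric] gcd_quot_dvd[OF a] pos by (auto simp: g_def intro: Nat.gr0I)
  have l: "0 < l" "[a ^ l = 1] (mod int n\<^sub>2)"
    using ord_int_pos[OF pos2 coprime2[OF a]] pos2 by (auto simp: l_def ord_int_divides)
  have lift: "ord (int n\<^sub>1) a dvd l * m \<longleftrightarrow> n\<^sub>1 div g dvd m" for m
  proof -
    have "ord (int n\<^sub>1) a dvd l * m \<longleftrightarrow> int n\<^sub>1 dvd mult_rem n\<^sub>2 a * int m"
      using dvd_power_iff[OF l(2), of m] pos
      by (simp add: ord_int_divides mult_rem_def flip: power_mult l_def)
    also have "\<dots> \<longleftrightarrow> int n\<^sub>1 div gcd (int n\<^sub>1) (mult_rem n\<^sub>2 a) dvd int m"
    proof -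
      define h where "h = gcd (int n\<^sub>1) (mult_rem n\<^sub>2 a)"
      define u where "u = int n\<^sub>1 div h"
      define v where "v = mult_rem n\<^sub>2 a div h"
      have h: "h \<noteq> 0" "int n\<^sub>1 = h * u" "mult_rem n\<^sub>2 a = h * v"
        using pos by (auto simp: h_def u_def v_def)
      have "coprime u v"
        using pos unfolding u_def v_def h_def by (intro div_gcd_coprime) auto
      then show ?thesis
        unfolding h_def[symmetric] u_def[symmetric] unfolding h(2,3)
        using h(1) by (simp add: mult.assoc coprime_dvd_mult_right_iff)
    qed
    also have "\<dots> \<longleftrightarrow> n\<^sub>1 div g dvd m"
      by (simp flip: g(1) of_nat_div)
    finally show ?thesis .
  qed
  have "[a ^ ord (int n\<^sub>1) a = 1] (mod int n\<^sub>1)"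
    using pos by (simp add: ord_int_divides)
  then have "[a ^ ord (int n\<^sub>1) a = 1] (mod int n\<^sub>2)"
    using dvd by (meson cong_dvd_modulus int_dvd_int_iff)
  then obtain m where m: "ord (int n\<^sub>1) a = l * m"
    using pos2 by (auto simp: ord_int_divides l_def)
  have "n\<^sub>1 div g dvd m"
    using lift[of m] m by simp
  moreover have "m dvd n\<^sub>1 div g"
    using lift[of "n\<^sub>1 div g"] m l(1) by simp
  ultimately have "m = n\<^sub>1 div g"
    by (rule dvd_antisym[rotated])
  with m show ?thesis by (simp add: l_def g_def)
qed

text \<open>With \<open>n\<^sub>1 = n\<^sub>2 * G * c\<close>, the order of \<open>a\<close> modulo
  \<open>n\<^sub>1\<close> is \<open>l * c\<close>, and \<open>c\<close> cancels when the order of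
  the power is formed. What remains, \<open>l div gcd l (n\<^sub>2 * G)\<close>, is reached in two
  stages: division by \<open>gcd l n\<^sub>2\<close>, then by the gcd of the quotient with
  \<open>G\<close>.\<close>

lemma ord_power_lift:
  assumes a: "coprime a (int n\<^sub>1)"
  shows "ord (int n\<^sub>1) (a ^ n\<^sub>1) =
    ord (int n\<^sub>2) (a ^ n\<^sub>2) div gcd (ord (int n\<^sub>2) (a ^ n\<^sub>2)) (gcd_quot a)"
proof -
  define l where "l = ord (int n\<^sub>2) a"
  define c where "c = n\<^sub>1 div (n\<^sub>2 * gcd_quot a)"
  have n1: "n\<^sub>1 = n\<^sub>2 * gcd_quot a * c"
    using gcd_quot_dvd[OF a] by (simp add: c_def)
  have c: "0 < c" using n1 pos by (intro Nat.gr0I) auto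
  have l: "0 < l" using ord_int_pos[OF pos2 coprime2[OF a]] by (simp add: l_def)
  have "ord (int n\<^sub>1) (a ^ n\<^sub>1) = (l * c) div gcd (l * c) (n\<^sub>2 * gcd_quot a * c)"
    using ord_int_power[OF pos a] ord_lift[OF a] n1 by (simp add: l_def c_def)
  also have "\<dots> = l div gcd l (n\<^sub>2 * gcd_quot a)"
    using c by (simp add: gcd_mult_right gcd.commute)
  finally have 1: "ord (int n\<^sub>1) (a ^ n\<^sub>1) = l div gcd l (n\<^sub>2 * gcd_quot a)" .
  define d where "d = gcd l n\<^sub>2"
  define k where "k = l div d"
  have d: "l = k * d" "0 < d" using l by (auto simp: d_def k_def)
  \<comment> \<open>Multiplying by \<open>d = gcd l n\<^sub>2\<close> gives the gcd of
    \<open>l\<close>, \<open>G * l\<close> and \<open>G * n\<^sub>2\<close>; the middle entry is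
    absorbed by \<open>l\<close>.\<close>
  have "gcd k (gcd_quot a) * d = gcd l (n\<^sub>2 * gcd_quot a)"
  proof -
    have "gcd k (gcd_quot a) * d = gcd (k * d) (gcd_quot a * d)"
      by (simp add: gcd_mult_right gcd.commute)
    also have "\<dots> = gcd l (gcd (gcd_quot a * l) (gcd_quot a * n\<^sub>2))"
      by (simp add: d(1)[symmetric]) (simp add: d_def gcd_mult_left)
    also have "\<dots> = gcd l (n\<^sub>2 * gcd_quot a)"
      by (simp add: mult.commute flip: gcd.assoc)
    finally show ?thesis .
  qed
  then have "l div gcd l (n\<^sub>2 * gcd_quot a) = (k * d) div (gcd k (gcd_quot a) * d)"
    using d(1) by simp
  also have "\<dots> = k div gcd k (gcd_quot a)"
    using d(2) by simp
  finally show ?thesis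
    using 1 ord_int_power[OF pos2 coprime2[OF a]] by (simp add: k_def d_def l_def)
qed

section \<open>Powers congruent to -1\<close>

lemma ex_minus_1_iff:
  fixes a :: int
  assumes "\<not> 4 dvd n\<^sub>1"
  shows "(\<exists>j. [(a ^ n\<^sub>1) ^ j = - 1] (mod int n\<^sub>1)) \<longleftrightarrow> (\<exists>j. [(a ^ n\<^sub>2) ^ j = - 1] (mod int n\<^sub>2))"
proof -
  obtain k where k: "n\<^sub>1 = n\<^sub>2 * k" using dvd by (elim dvdE)
  \<comment> \<open>An even \<open>k\<close> would make \<open>n\<^sub>1\<close>, hence
    \<open>n\<^sub>2\<close>, even, and then 4 would divide \<open>n\<^sub>1\<close>.\<close>
  have "odd k"
  proof
    assume "even k"
    then have "2 dvd n\<^sub>2" using k primes[of 2] by simp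
    with \<open>even k\<close> have "2 * 2 dvd n\<^sub>1" unfolding k by (rule mult_dvd_mono[rotated])
    with assms show False by simp
  qed
  show ?thesis
  proof
    assume "\<exists>j. [(a ^ n\<^sub>1) ^ j = - 1] (mod int n\<^sub>1)"
    then obtain j where "[(a ^ n\<^sub>1) ^ j = - 1] (mod int n\<^sub>1)" ..
    then have "[(a ^ n\<^sub>2) ^ (k * j) = - 1] (mod int n\<^sub>2)"
      using dvd by (metis cong_dvd_modulus int_dvd_int_iff k power_mult)
    then show "\<exists>j. [(a ^ n\<^sub>2) ^ j = - 1] (mod int n\<^sub>2)" ..
  next
    assume "\<exists>j. [(a ^ n\<^sub>2) ^ j = - 1] (mod int n\<^sub>2)"
    then obtain j where j: "[(a ^ n\<^sub>2) ^ j = - 1] (mod int n\<^sub>2)" ..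
    define y where "y = (a ^ n\<^sub>2) ^ j"
    \<comment> \<open>Lifting starts from the residue 1, so it is applied to \<open>- y\<close>; the
      odd exponent \<open>k\<close> then restores the sign.\<close>
    have y: "[- y = 1] (mod int n\<^sub>2)"
      using j by (metis cong_minus_minus_iff minus_minus y_def)
    then have "int n\<^sub>2 dvd - y - 1"
      by (simp add: cong_iff_dvd_diff)
    then have "int n\<^sub>1 dvd (- y - 1) * int k"
      unfolding k by (simp add: mult_dvd_mono)
    with dvd_power_iff[OF y] have "[(- y) ^ k = 1] (mod int n\<^sub>1)" by blast
    then have "[y ^ k = - 1] (mod int n\<^sub>1)"
      using \<open>odd k\<close> by (metis cong_minus_minus_iff minus_minus power_minus_odd)
    moreover have "y ^ k = (a ^ n\<^sub>1) ^ j"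
      by (simp add: y_def k mult_ac flip: power_mult)
    ultimately show "\<exists>j. [(a ^ n\<^sub>1) ^ j = - 1] (mod int n\<^sub>1)" by auto
  qed
qed

text \<open>An even quotient would force \<open>n\<^sub>2\<close> to be even as well, so 4 would
  divide their product and thus \<open>n\<^sub>1\<close>.\<close>

lemma odd_gcd_quot:
  assumes "coprime a (int n\<^sub>1)" "\<not> 4 dvd n\<^sub>1"
  shows "odd (gcd_quot a)"
proof
  assume G: "even (gcd_quot a)"
  then have "2 dvd n\<^sub>1"
    using gcd_quot_dvd[OF assms(1)] by (meson dvd_mult dvd_trans)
  then have "2 dvd n\<^sub>2" using primes[of 2] by simp
  with G have "2 * 2 dvd n\<^sub>2 * gcd_quot a" by (intro mult_dvd_mono)
  with gcd_quot_dvd[OF assms(1)] assms(2) show False by (auto intro: dvd_trans)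
qed

end

text \<open>Such a power is a square, and \<open>-1\<close> is not a square modulo 4.\<close>

lemma power_modulus_not_cong_minus_1:
  fixes a :: int
  assumes "4 dvd n"
  shows "\<not> [(a ^ n) ^ j = - 1] (mod int n)"
proof
  assume "[(a ^ n) ^ j = - 1] (mod int n)"
  moreover have "4 dvd int n" using assms by presburger
  ultimately have 1: "[(a ^ n) ^ j = - 1] (mod 4)" by (rule cong_dvd_modulus)
  from assms obtain r where "n = 2 * r" by (metis dvdE mult.assoc mult_2_right numeral_Bit0)
  then have "(a ^ n) ^ j = (a ^ (r * j)) ^ 2"
    by (simp add: mult_ac flip: power_mult)
  with 1 have "(a ^ (r * j)) ^ 2 mod 4 = 3" by (simp add: cong_def)
  moreover have "z ^ 2 mod 4 \<noteq> 3" for z :: int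
  proof (cases "even z")
    case False
    then obtain w where "z = 2 * w + 1" by (rule oddE)
    then have "z ^ 2 = 1 + 4 * (w ^ 2 + w)" by (simp add: power2_eq_square algebra_simps)
    then show ?thesis by presburger
  qed (auto simp: power2_eq_square elim!: evenE)
  ultimately show False by blast
qed

theorem theorem3p3:
  fixes n\<^sub>1 n\<^sub>2 :: nat and a :: int
  assumes "0 < n\<^sub>1" and "0 < n\<^sub>2"
    and "multiplicity 2 n\<^sub>1 \<le> 1 \<Longrightarrow> rad n\<^sub>1 dvd n\<^sub>2 \<and> n\<^sub>2 dvd n\<^sub>1"
    and "multiplicity 2 n\<^sub>1 \<ge> 2 \<Longrightarrow> 2 * rad n\<^sub>1 dvd n\<^sub>2 \<and> n\<^sub>2 dvd n\<^sub>1"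
    and "coprime a (int n\<^sub>1)" and "coprime a (int n\<^sub>2)"
  shows "beta n\<^sub>1 a =
    beta n\<^sub>2 a div gcd (beta n\<^sub>2 a) (nat (gcd (int n\<^sub>1) (mult_rem n\<^sub>2 a)) div n\<^sub>2)"
proof -
  have "n\<^sub>2 dvd n\<^sub>1" "rad n\<^sub>1 dvd n\<^sub>2"
    using assms(3,4) by (cases "multiplicity 2 n\<^sub>1 \<le> 1"; force dest: dvd_mult_right)+
  have rad: "p dvd rad n\<^sub>1" if "prime p" "p dvd n\<^sub>1" for p
    using that assms(1) unfolding rad_def
    by (intro dvd_prodI[of _ _ "\<lambda>x. x", simplified]) (auto simp: prime_factors_dvd)
  interpret divisor_with_same_primes n\<^sub>1 n\<^sub>2
  proof
    assume "4 dvd n\<^sub>1"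
    then have "2 ^ 2 dvd n\<^sub>1" by simp
    with assms(1) have "2 \<le> multiplicity 2 n\<^sub>1" by (intro multiplicity_geI) auto
    then have "2 * rad n\<^sub>1 dvd n\<^sub>2" using assms(4) by blast
    \<comment> \<open>The radical of an even number is even.\<close>
    moreover have "2 * 2 dvd 2 * rad n\<^sub>1"
      using rad[of 2] \<open>4 dvd n\<^sub>1\<close> by (intro mult_dvd_mono) auto
    ultimately show "4 dvd n\<^sub>2" by (auto intro: dvd_trans)
  qed (use assms rad \<open>n\<^sub>2 dvd n\<^sub>1\<close> \<open>rad n\<^sub>1 dvd n\<^sub>2\<close> in \<open>auto intro: dvd_trans\<close>)
  \<comment> \<open>For these coprime moduli \<open>b\<close> is \<open>beta\<close>, and
    \<open>d\<close> is its counterpart with the ordinary order, for which the formula is already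
    known.\<close>
  define b where "b n = proj_ord n (a ^ n)" for n
  define d where "d n = ord (int n) (a ^ n)" for n
  have d: "d n\<^sub>1 = d n\<^sub>2 div gcd (d n\<^sub>2) (gcd_quot a)"
    using ord_power_lift[OF assms(5)] by (simp add: d_def)
  have cop: "coprime (a ^ n\<^sub>1) (int n\<^sub>1)" "coprime (a ^ n\<^sub>2) (int n\<^sub>2)"
    using assms by auto
  have "b n\<^sub>1 = b n\<^sub>2 div gcd (b n\<^sub>2) (gcd_quot a)"
  proof (cases "4 dvd n\<^sub>1 \<or> (\<nexists>j. [(a ^ n\<^sub>2) ^ j = - 1] (mod int n\<^sub>2))")
    case True
    \<comment> \<open>If 4 divides \<open>n\<^sub>1\<close>, it divides both moduli and -1 is
      excluded for each; otherwise its absence transfers from \<open>n\<^sub>2\<close> to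
      \<open>n\<^sub>1\<close>.\<close>
    then have "\<not> [(a ^ n\<^sub>1) ^ j = - 1] (mod int n\<^sub>1)" "\<not> [(a ^ n\<^sub>2) ^ j = - 1] (mod int n\<^sub>2)" for j
      using power_modulus_not_cong_minus_1 four ex_minus_1_iff by blast+
    then have "b n\<^sub>1 = d n\<^sub>1" "b n\<^sub>2 = d n\<^sub>2"
      using assms(1,2) cop by (auto simp: b_def d_def intro!: proj_ord_eq_ord)
    with d show ?thesis by simp
  next
    case False
    then have not4: "\<not> 4 dvd n\<^sub>1" by blast
    from False obtain i j where ij: "[(a ^ n\<^sub>1) ^ i = - 1] (mod int n\<^sub>1)" "[(a ^ n\<^sub>2) ^ j = - 1] (mod int n\<^sub>2)"
      using ex_minus_1_iff by blast
    show ?thesis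
    proof (cases "n\<^sub>2 > 2")
      case True
      with \<open>n\<^sub>2 dvd n\<^sub>1\<close> assms(1) have "n\<^sub>1 > 2" by (auto dest: dvd_imp_le)
      with True ij cop have "d n\<^sub>1 = 2 * b n\<^sub>1" "d n\<^sub>2 = 2 * b n\<^sub>2"
        by (auto simp: b_def d_def intro!: ord_eq_double_proj_ord)
      \<comment> \<open>The factor 2 does not affect the gcd with an odd number, so it cancels from
        the formula for \<open>d\<close>.\<close>
      moreover have "gcd (2 * b n\<^sub>2) (gcd_quot a) = gcd (b n\<^sub>2) (gcd_quot a)"
        using odd_gcd_quot assms(5) False by (intro gcd_mult_left_left_cancel) auto
      ultimately show ?thesis
        using d div_mult_swap[of "gcd (b n\<^sub>2) (gcd_quot a)" "b n\<^sub>2" 2] by simp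
    next
      case False
      obtain k where k: "n\<^sub>1 = n\<^sub>2 * k" using \<open>n\<^sub>2 dvd n\<^sub>1\<close> by (elim dvdE)
      \<comment> \<open>For \<open>n\<^sub>2\<close> at most 2 the residues 1 and -1 coincide and
        doubling fails. But a prime factor of \<open>k\<close> divides \<open>n\<^sub>2\<close>, so
        it is 2 and 4 divides \<open>n\<^sub>1\<close>, which is excluded. Hence the moduli are
        equal and the quotient G is 1.\<close>
      have "k = 1"
      proof (rule ccontr)
        assume "k \<noteq> 1"
        then obtain p where p: "prime p" "p dvd k" by (rule prime_factor_nat[THEN exE]) auto
        with k have "p dvd n\<^sub>2" by (intro primes) auto
        with p(1) False assms(2) have "p = 2" "n\<^sub>2 = 2"
          using dvd_imp_le[of p n\<^sub>2] prime_ge_2_nat[of p] by auto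
        with p(2) k not4 show False by auto
      qed
      with k gcd_quot_dvd[OF assms(5)] assms(2) show ?thesis by simp
    qed
  qed
  with assms(5,6) show ?thesis by (simp add: beta_def b_def gcd_quot_def)
qed

end
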